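(* Let $\Omega$ be a finite set, let $k,l \geq 2$ be multiplicatively independent integers, and let $f \colon \mathbb{N}_0 \to \Omega$ be a sequence. Suppose that $f$ is asymptotically $k$-automatic and asymptotically $l$-automatic. Then $f$ is asymptotically invariant under a non-zero shift, i.e. there exists $q \in \mathbb{N}$ such that $f(n+q) = f(n)$ for almost all $n \in \mathbb{N}_0$.
   Context: $\mathbb{N} = \{1,2,\dots\}$, $\mathbb{N}_0 = \mathbb{N}\cup\{0\}$. Integers $k,l\geq 2$ are multiplicatively dependent if $\log k/\log l \in \mathbb{Q}$, and multiplicatively independent otherwise. For $A \subset \mathbb{N}_0$, the upper density is $\bar d(A) = \limsup_{N\to\infty} |A\cap\{0,\dots,N-1\}|/N$; a property holds for almost all $n\in\mathbb{N}_0$ if the set of $n$ where it fails has upper density $0$. Two sequences $f,g\colon \mathbb{N}_0\to\Omega$ are asymptotically equal, written $f\simeq g$, if $f(n)=g(n)$ for almost all $n$. The $k$-kernel of $f$ is $\mathcal{N}_k(f) = \{ n \mapsto f(k^\alpha n + r) : \alpha, r \in \mathbb{N}_0,\ r < k^\alpha\}$. The sequence $f$ (with $\Omega$ finite) is asymptotically $k$-automatic if the set of equivalence classes $\mathcal{N}_k(f)/{\simeq}$ is finite. *)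

theory Defs
  imports "HOL-Analysis.Analysis"
begin

definition upper_density :: "nat set \<Rightarrow> ereal" where
  "upper_density A = limsup (\<lambda>N. ereal (real (card (A \<inter> {0..<N})) / real N))"

definition almost_all :: "(nat \<Rightarrow> bool) \<Rightarrow> bool" where
  "almost_all P \<longleftrightarrow> upper_density {n. \<not> P n} = 0"

definition asymp_eq :: "(nat \<Rightarrow> 'a) \<Rightarrow> (nat \<Rightarrow> 'a) \<Rightarrow> bool" where
  "asymp_eq f g \<longleftrightarrow> almost_all (\<lambda>n. f n = g n)"

definition kernel :: "nat \<Rightarrow> (nat \<Rightarrow> 'a) \<Rightarrow> (nat \<Rightarrow> 'a) set" where
  "kernel k f = {(\<lambda>n. f (k ^ \<alpha> * n + r)) | \<alpha> r. r < k ^ \<alpha>}"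

definition asymp_automatic :: "nat \<Rightarrow> (nat \<Rightarrow> 'a) \<Rightarrow> bool" where
  "asymp_automatic k f \<longleftrightarrow>
     finite (kernel k f // {(g, h). g \<in> kernel k f \<and> h \<in> kernel k f \<and> asymp_eq g h})"

definition mult_independent :: "nat \<Rightarrow> nat \<Rightarrow> bool" where
  "mult_independent k l \<longleftrightarrow> ln (real k) / ln (real l) \<notin> \<rat>"

end

theory Submission
  imports Defs
begin

text \<open>
  Up to a set of density zero, the block of \<open>f\<close> on \<open>[K x, K (x + 2))\<close> with \<open>K = k ^ m\<close> depends
  only on a finite-valued \<open>F x\<close> that does not involve \<open>m\<close>; likewise the block on
  \<open>[M x', M (x' + 3))\<close> with \<open>M = l ^ n\<close> depends only on some \<open>G x'\<close>. Choose \<open>K < M\<close> with \<open>M / K\<close>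
  very close to 1, and put \<open>x' = \<lfloor>x K / M\<rfloor>\<close>, so that the second interval covers the first. In each
  class of \<open>F\<close> of positive upper density, pigeonhole yields \<open>x\<close> and \<open>y = x + p\<close> with \<open>p\<close> bounded
  independently of \<open>m\<close> and \<open>n\<close>, with \<open>y' = x' + p\<close> and \<open>G x' = G y'\<close>. The block at \<open>x\<close> then
  recurs both at distance \<open>p K\<close> and at distance \<open>p M\<close>, so the block of this class has the short
  period \<open>p (M - K)\<close>. A common multiple of these periods that is still at most \<open>K\<close> is an
  asymptotic period of \<open>f\<close>.
\<close>

section \<open>Sets of density zero\<close>

definition density_zero :: "nat set \<Rightarrow> bool" where
  "density_zero E \<longleftrightarrow>
     (\<forall>e>0. \<forall>\<^sub>F N in sequentially. real (card (E \<inter> {0..<N})) \<le> e * real N)"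

lemma upper_density_eq_0_iff: "upper_density E = 0 \<longleftrightarrow> density_zero E"
proof
  assume E: "upper_density E = 0"
  show "density_zero E"
    unfolding density_zero_def
  proof (intro allI impI)
    fix e :: real assume "e > 0"
    then have "limsup (\<lambda>N. ereal (real (card (E \<inter> {0..<N})) / real N)) < ereal e"
      using E by (simp add: upper_density_def)
    then have "\<forall>\<^sub>F N in sequentially. ereal (real (card (E \<inter> {0..<N})) / real N) < ereal e"
      by (rule Limsup_lessD)
    then show "\<forall>\<^sub>F N in sequentially. real (card (E \<inter> {0..<N})) \<le> e * real N"
      using eventually_gt_at_top[of 0] by eventually_elim (simp add: field_simps)
  qed
next
  assume E: "density_zero E"
  show "upper_density E = 0"
  proof (rule antisym)
    show "upper_density E \<le> 0"
    proof (rule ereal_le_epsilon2)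
      fix e :: real assume "e > 0"
      then have "\<forall>\<^sub>F N in sequentially. real (card (E \<inter> {0..<N})) \<le> e * real N"
        using E by (simp add: density_zero_def)
      then have "\<forall>\<^sub>F N in sequentially. ereal (real (card (E \<inter> {0..<N})) / real N) \<le> ereal e"
        using eventually_gt_at_top[of 0] by eventually_elim (simp add: field_simps)
      then show "upper_density E \<le> 0 + ereal e"
        by (simp add: upper_density_def Limsup_bounded)
    qed
    show "0 \<le> upper_density E"
      unfolding upper_density_def by (rule le_Limsup) auto
  qed
qed

lemma almost_all_iff: "almost_all P \<longleftrightarrow> density_zero {n. \<not> P n}"
  by (simp add: almost_all_def upper_density_eq_0_iff)

lemma density_zero_subset:
  assumes "density_zero E" "E' \<subseteq> E"
  shows "density_zero E'"
  unfolding density_zero_def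
proof (intro allI impI)
  fix e :: real assume "e > 0"
  with assms(1) have "\<forall>\<^sub>F N in sequentially. real (card (E \<inter> {0..<N})) \<le> e * real N"
    by (simp add: density_zero_def)
  then show "\<forall>\<^sub>F N in sequentially. real (card (E' \<inter> {0..<N})) \<le> e * real N"
  proof eventually_elim
    case (elim N)
    have "card (E' \<inter> {0..<N}) \<le> card (E \<inter> {0..<N})"
      using assms(2) by (intro card_mono) auto
    with elim show ?case by linarith
  qed
qed

lemma density_zero_Un:
  assumes "density_zero E" "density_zero E'"
  shows "density_zero (E \<union> E')"
  unfolding density_zero_def
proof (intro allI impI)
  fix e :: real assume "e > 0"
  with assms have "\<forall>\<^sub>F N in sequentially. real (card (E \<inter> {0..<N})) \<le> (e/2) * real N"
    "\<forall>\<^sub>F N in sequentially. real (card (E' \<inter> {0..<N})) \<le> (e/2) * real N"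
    unfolding density_zero_def by (meson half_gt_zero)+
  then show "\<forall>\<^sub>F N in sequentially. real (card ((E \<union> E') \<inter> {0..<N})) \<le> e * real N"
  proof eventually_elim
    case (elim N)
    have "card ((E \<union> E') \<inter> {0..<N}) \<le> card (E \<inter> {0..<N}) + card (E' \<inter> {0..<N})"
      by (metis Int_Un_distrib2 card_Un_le)
    with elim show ?case by (simp add: field_simps)
  qed
qed

lemma density_zero_UN:
  assumes "finite I" "\<And>i. i \<in> I \<Longrightarrow> density_zero (E i)"
  shows "density_zero (\<Union>i\<in>I. E i)"
  using assms
proof (induction I rule: finite_induct)
  case empty
  then show ?case by (simp add: density_zero_def)
next
  case (insert i I)
  then show ?case by (simp add: density_zero_Un)
qed

text \<open>Each element of \<open>E\<close> below \<open>N + c\<close> has at most \<open>C\<close>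
  preimages, so counting points grows by a factor of at most \<open>C\<close>. Finiteness of the
  fibres is assumed separately because \<open>card\<close> of an infinite set is 0.\<close>

lemma density_zero_vimage:
  fixes g :: "nat \<Rightarrow> nat"
  assumes "density_zero E"
    and g_le: "\<And>n. g n \<le> n + c"
    and fib: "\<And>n. finite {i. g i = n}" "\<And>n. card {i. g i = n} \<le> C"
  shows "density_zero {n. g n \<in> E}"
  unfolding density_zero_def
proof (intro allI impI)
  fix e :: real assume "e > 0"
  \<comment> \<open>The 2 absorbs \<open>N + c \<le> 2 * N\<close>, valid for
    \<open>N \<ge> c\<close>; adding 1 keeps the denominator positive when
    \<open>C = 0\<close>.\<close>
  define e' where "e' = e / (2 * (real C + 1))"
  have e': "e' > 0" using \<open>e > 0\<close> by (simp add: e'_def)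
  then have "\<forall>\<^sub>F N in sequentially. real (card (E \<inter> {0..<N})) \<le> e' * real N"
    using assms(1) by (simp add: density_zero_def)
  then have "\<forall>\<^sub>F N in sequentially. real (card (E \<inter> {0..<N + c})) \<le> e' * real (N + c)"
    by (subst (asm) eventually_sequentially_seg[symmetric, of _ c])
  then show "\<forall>\<^sub>F N in sequentially. real (card ({n. g n \<in> E} \<inter> {0..<N})) \<le> e * real N"
    using eventually_ge_at_top[of c]
  proof eventually_elim
    case (elim N)
    have "{n. g n \<in> E} \<inter> {0..<N} \<subseteq> (\<Union>m\<in>E \<inter> {0..<N + c}. {i. g i = m})"
      using le_less_trans[OF g_le] by auto
    then have "card ({n. g n \<in> E} \<inter> {0..<N}) \<le> card (\<Union>m\<in>E \<inter> {0..<N + c}. {i. g i = m})"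
      using fib by (intro card_mono) auto
    also have "\<dots> \<le> (\<Sum>m\<in>E \<inter> {0..<N + c}. card {i. g i = m})"
      by (rule card_UN_le) auto
    also have "\<dots> \<le> (\<Sum>m\<in>E \<inter> {0..<N + c}. C)"
      by (intro sum_mono fib)
    finally have "card ({n. g n \<in> E} \<inter> {0..<N}) \<le> card (E \<inter> {0..<N + c}) * C"
      by simp
    then have "real (card ({n. g n \<in> E} \<inter> {0..<N})) \<le> real (card (E \<inter> {0..<N + c})) * real C"
      by (metis of_nat_le_iff of_nat_mult)
    also have "\<dots> \<le> (e' * real (N + c)) * (real C + 1)"
      using elim e' by (intro mult_mono) auto
    also have "\<dots> = e / 2 * real (N + c)"
      by (simp add: e'_def field_simps)
    also have "\<dots> \<le> e / 2 * (2 * real N)"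
      using elim \<open>e > 0\<close> by (intro mult_left_mono) auto
    finally show ?case by simp
  qed
qed

lemma density_zero_shift: "density_zero {n. n + i \<in> E}" if "density_zero E"
proof (rule density_zero_vimage[OF that, where c = i and C = 1])
  fix n
  have "{j. j + i = n} \<subseteq> {n - i}" by auto
  then show "finite {j. j + i = n}" "card {j. j + i = n} \<le> 1"
    by (auto intro: finite_subset dest: card_mono[rotated])
qed auto

text \<open>On a fibre, the multiples \<open>i * K\<close> lie in a window of length
  \<open>M\<close>, so the fibre has at most \<open>M\<close> elements. This carries exceptional
  sets of \<open>M\<close>-block indices back to \<open>K\<close>-block indices, and, with 1 in
  place of \<open>K\<close>, those of block indices back to positions.\<close>

lemma density_zero_scale_div:
  fixes K M :: nat
  assumes "density_zero E" "0 < K" "K \<le> M"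
  shows "density_zero {n. n * K div M \<in> E}"
proof (rule density_zero_vimage[OF assms(1), where c = 0 and C = M])
  fix n
  show "n * K div M \<le> n + 0"
    using assms by (metis add.right_neutral div_le_mono div_mult_self_is_m less_le_trans
        mult_le_mono2)
  have sub: "{i. i * K div M = n} \<subseteq> {i. n * M \<le> i * K \<and> i * K < n * M + M}"
  proof safe
    fix i assume "n = i * K div M"
    then show "i * K div M * M \<le> i * K" "i * K < i * K div M * M + M"
      using assms by (auto simp: dividend_less_div_times add.commute)
  qed
  have "{i. i * K div M = n} \<subseteq> {..<(n + 1) * M}"
  proof
    fix i assume "i \<in> {i. i * K div M = n}"
    with sub have "i * K < n * M + M" by auto
    moreover have "i * 1 \<le> i * K" using assms by (intro mult_le_mono) auto
    ultimately have "i < n * M + M" by linarith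
    then show "i \<in> {..<(n + 1) * M}" by simp
  qed
  then show fin: "finite {i. i * K div M = n}" by (rule finite_subset) simp
  have "inj_on (\<lambda>i. i * K - n * M) {i. i * K div M = n}"
  proof (rule inj_onI)
    fix x y assume xy: "x \<in> {i. i * K div M = n}" "y \<in> {i. i * K div M = n}"
      "x * K - n * M = y * K - n * M"
    with sub have "n * M \<le> x * K" "n * M \<le> y * K" by auto
    with xy(3) have "x * K = y * K" by linarith
    then show "x = y" using assms by simp
  qed
  moreover have "(\<lambda>i. i * K - n * M) ` {i. i * K div M = n} \<subseteq> {..<M}"
  proof (rule image_subsetI)
    fix i assume "i \<in> {i. i * K div M = n}"
    with sub have "n * M \<le> i * K" "i * K < n * M + M" by blast+
    then show "i * K - n * M \<in> {..<M}" by simp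
  qed
  ultimately have "card {i. i * K div M = n} \<le> card {..<M}"
    by (intro card_inj_on_le) auto
  then show "card {i. i * K div M = n} \<le> M" by simp
qed

lemma not_density_zeroE:
  assumes "\<not> density_zero A"
  obtains d where "d > 0" "\<exists>\<^sub>F N in sequentially. real (card (A \<inter> {0..<N})) > d * real N"
  using assms unfolding density_zero_def frequently_def
  by (metis (mono_tags, lifting) eventually_mono not_le)

section \<open>Close powers of multiplicatively independent integers\<close>

text \<open>The ratio of logarithms is irrational, so some multiple of it by \<open>m\<close> lies
  just below an integer \<open>n\<close>; exponentiate to base \<open>l\<close>.\<close>

lemma mult_independent_powers_close:
  assumes "mult_independent k l" "k \<ge> 2" "l \<ge> 2" "e > 0"
  obtains m n where "k ^ m < l ^ n" "real (l ^ n) < (1 + e) * real (k ^ m)"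
proof -
  define \<theta> where "\<theta> = ln (real k) / ln (real l)"
  have ln: "ln (real k) > 0" "ln (real l) > 0" using assms by auto
  define e' where "e' = ln (1 + e) / ln (real l)"
  have "e' > 0" using ln assms by (simp add: e'_def)
  have "\<theta> \<notin> \<rat>" using assms(1) by (simp add: mult_independent_def \<theta>_def)
  \<comment> \<open>Aiming the fractional part at 1 makes rounding up cheap: \<open>n\<close>
    exceeds \<open>m * \<theta>\<close> by less than \<open>e'\<close>, the base-\<open>l\<close>
    logarithm of \<open>1 + e\<close>. As \<open>frac\<close> stays below 1, the excess is strictly
    positive.\<close>
  then obtain m where m: "m > 0" "\<bar>frac (real m * \<theta>) - 1\<bar> < e'"
    using Kronecker_approx_1_explicit[of \<theta> 1 e'] \<open>e' > 0\<close> by auto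
  define n where "n = nat (\<lfloor>real m * \<theta>\<rfloor> + 1)"
  have "\<theta> > 0" using ln by (simp add: \<theta>_def)
  then have n: "real n = of_int \<lfloor>real m * \<theta>\<rfloor> + 1" by (simp add: n_def)
  have "frac (real m * \<theta>) < 1" by (rule frac_lt_1)
  then have "real m * \<theta> < real n" "real n < real m * \<theta> + e'"
    using m(2) unfolding n frac_def by linarith+
  then have "real m * \<theta> * ln l < real n * ln l" "real n * ln l < (real m * \<theta> + e') * ln l"
    using ln by auto
  moreover have "real m * \<theta> * ln l = ln (real (k ^ m))" "real n * ln l = ln (real (l ^ n))"
    using ln assms by (auto simp: \<theta>_def ln_realpow)
  moreover have "(real m * \<theta> + e') * ln l = ln ((1 + e) * real (k ^ m))"
    using ln assms by (subst ln_mult) (auto simp: \<theta>_def e'_def ln_realpow distrib_right)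
  ultimately have "ln (real (k ^ m)) < ln (real (l ^ n))"
    "ln (real (l ^ n)) < ln ((1 + e) * real (k ^ m))" by simp_all
  moreover have "real (k ^ m) > 0" "real (l ^ n) > 0" "(1 + e) * real (k ^ m) > 0"
    using assms by auto
  ultimately have "real (k ^ m) < real (l ^ n)" "real (l ^ n) < (1 + e) * real (k ^ m)"
    by (simp_all only: ln_less_cancel_iff)
  then show thesis using that by (metis of_nat_less_iff)
qed

section \<open>Finite-valued labels that determine blocks\<close>

text \<open>\<open>F x\<close> records the values at \<open>x\<close> of one representative per
  kernel class. Each entry of the block at \<open>x\<close> is a kernel sequence evaluated at
  \<open>x\<close>, hence agrees with a recorded value off a set of density zero. Only that set
  depends on \<open>\<alpha>\<close>.\<close>

lemma asymp_automatic_single_blocks: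
  fixes f :: "nat \<Rightarrow> 'a"
  assumes "finite \<Omega>" "\<And>n. f n \<in> \<Omega>" "asymp_automatic k f"
  obtains F :: "nat \<Rightarrow> (nat \<Rightarrow> 'a) \<Rightarrow> 'a"
  where "finite (range F)"
    and "\<And>\<alpha>. \<exists>E. density_zero E \<and> (\<forall>x y. x \<notin> E \<longrightarrow> y \<notin> E \<longrightarrow> F x = F y \<longrightarrow>
           (\<forall>r<k ^ \<alpha>. f (k ^ \<alpha> * x + r) = f (k ^ \<alpha> * y + r)))"
proof -
  define rel where "rel = {(g, h). g \<in> kernel k f \<and> h \<in> kernel k f \<and> asymp_eq g h}"
  have fin: "finite (kernel k f // rel)"
    using assms(3) by (simp add: asymp_automatic_def rel_def)
  \<comment> \<open>\<open>rel\<close> is reflexive on the kernel, so the class of \<open>g\<close>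
    is nonempty and \<open>SOME\<close> picks a member.\<close>
  have class_rep: "(SOME h. h \<in> rel `` {g}) \<in> rel `` {g}" if "g \<in> kernel k f" for g
    using that
    by (intro someI[of "\<lambda>h. h \<in> rel `` {g}" g])
      (simp add: rel_def asymp_eq_def almost_all_iff density_zero_def)
  define R where "R = (\<lambda>g. SOME h. h \<in> rel `` {g}) ` kernel k f"
  have "R = (\<lambda>C. SOME h. h \<in> C) ` (kernel k f // rel)"
    unfolding R_def quotient_def by blast
  then have finR: "finite R" using fin by simp
  have rep: "\<exists>h\<in>R. asymp_eq g h" if "g \<in> kernel k f" for g
    using class_rep[OF that] that by (auto simp: R_def rel_def)
  have R_kernel: "R \<subseteq> kernel k f"
    using class_rep by (auto simp: R_def rel_def)
  have R_\<Omega>: "h x \<in> \<Omega>" if "h \<in> R" for h x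
    using R_kernel that assms(2) by (auto simp: kernel_def)
  \<comment> \<open>Restricting to \<open>R\<close> places \<open>F x\<close> in a finite space of
    extensional functions.\<close>
  define F where "F x = restrict (\<lambda>h. h x) R" for x
  have "range F \<subseteq> R \<rightarrow>\<^sub>E \<Omega>" using R_\<Omega> by (auto simp: F_def)
  moreover have "finite (R \<rightarrow>\<^sub>E \<Omega>)" using finR assms(1) by (intro finite_PiE) auto
  ultimately have "finite (range F)" by (rule finite_subset)
  moreover have "\<exists>E. density_zero E \<and> (\<forall>x y. x \<notin> E \<longrightarrow> y \<notin> E \<longrightarrow> F x = F y \<longrightarrow>
           (\<forall>r<k ^ \<alpha>. f (k ^ \<alpha> * x + r) = f (k ^ \<alpha> * y + r)))" for \<alpha>
  proof -
    have "\<exists>h\<in>R. asymp_eq (\<lambda>n. f (k ^ \<alpha> * n + r)) h" if "r < k ^ \<alpha>" for r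
      using rep[of "\<lambda>n. f (k ^ \<alpha> * n + r)"] that by (auto simp: kernel_def)
    then obtain H where H: "\<And>r. r < k ^ \<alpha> \<Longrightarrow> H r \<in> R"
      "\<And>r. r < k ^ \<alpha> \<Longrightarrow> asymp_eq (\<lambda>n. f (k ^ \<alpha> * n + r)) (H r)"
      by metis
    define E where "E = (\<Union>r\<in>{..<k ^ \<alpha>}. {n. f (k ^ \<alpha> * n + r) \<noteq> H r n})"
    have "density_zero E"
      unfolding E_def using H(2) by (intro density_zero_UN) (auto simp: asymp_eq_def almost_all_iff)
    moreover have "f (k ^ \<alpha> * x + r) = f (k ^ \<alpha> * y + r)"
      if "x \<notin> E" "y \<notin> E" "F x = F y" "r < k ^ \<alpha>" for x y r
    proof -
      have "H r x = H r y" using that(3) H(1)[OF that(4)] by (metis F_def restrict_apply')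
      then show ?thesis using that by (auto simp: E_def)
    qed
    ultimately show ?thesis by blast
  qed
  ultimately show thesis by (rule that)
qed

text \<open>Listing the labels of \<open>s\<close> consecutive blocks controls an interval
  \<open>s\<close> times as long. Length 2 leaves room for a shift by at most one block; length 3
  lets an \<open>M\<close>-interval cover a \<open>K\<close>-interval that starts inside its first
  block.\<close>

lemma asymp_automatic_blocks:
  fixes f :: "nat \<Rightarrow> 'a"
  assumes "finite \<Omega>" "\<And>n. f n \<in> \<Omega>" "asymp_automatic k f"
  obtains F :: "nat \<Rightarrow> ((nat \<Rightarrow> 'a) \<Rightarrow> 'a) list"
  where "finite (range F)"
    and "\<And>\<alpha>. \<exists>E. density_zero E \<and> (\<forall>x y. x \<notin> E \<longrightarrow> y \<notin> E \<longrightarrow> F x = F y \<longrightarrow>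
           (\<forall>r<s * k ^ \<alpha>. f (k ^ \<alpha> * x + r) = f (k ^ \<alpha> * y + r)))"
proof -
  obtain F :: "nat \<Rightarrow> (nat \<Rightarrow> 'a) \<Rightarrow> 'a" where F: "finite (range F)"
    and block: "\<And>\<alpha>. \<exists>E. density_zero E \<and> (\<forall>x y. x \<notin> E \<longrightarrow> y \<notin> E \<longrightarrow> F x = F y \<longrightarrow>
           (\<forall>r<k ^ \<alpha>. f (k ^ \<alpha> * x + r) = f (k ^ \<alpha> * y + r)))"
    using asymp_automatic_single_blocks[OF assms] by metis
  define G where "G x = map (\<lambda>i. F (x + i)) [0..<s]" for x
  have "range G \<subseteq> {xs. set xs \<subseteq> range F \<and> length xs = s}"
    by (auto simp: G_def)
  then have "finite (range G)"
    using finite_lists_length_eq[OF F] by (rule finite_subset)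
  moreover have "\<exists>E. density_zero E \<and> (\<forall>x y. x \<notin> E \<longrightarrow> y \<notin> E \<longrightarrow> G x = G y \<longrightarrow>
           (\<forall>r<s * k ^ \<alpha>. f (k ^ \<alpha> * x + r) = f (k ^ \<alpha> * y + r)))" for \<alpha>
  proof -
    obtain E where E: "density_zero E"
      and EF: "\<And>x y r. x \<notin> E \<Longrightarrow> y \<notin> E \<Longrightarrow> F x = F y \<Longrightarrow> r < k ^ \<alpha> \<Longrightarrow>
           f (k ^ \<alpha> * x + r) = f (k ^ \<alpha> * y + r)"
      using block by metis
    define E' where "E' = (\<Union>i\<in>{..<s}. {x. x + i \<in> E})"
    have "density_zero E'"
      unfolding E'_def using E by (intro density_zero_UN density_zero_shift) auto
    moreover have "f (k ^ \<alpha> * x + r) = f (k ^ \<alpha> * y + r)"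
      if xy: "x \<notin> E'" "y \<notin> E'" "G x = G y" and r: "r < s * k ^ \<alpha>" for x y r
    proof -
      define i where "i = r div k ^ \<alpha>"
      have i: "i < s" using r by (simp add: i_def less_mult_imp_div_less)
      have "k ^ \<alpha> > 0" using r by (cases "k ^ \<alpha> = 0") auto
      then have r': "r mod k ^ \<alpha> < k ^ \<alpha>" by simp
      have "F (x + i) = F (y + i)" using xy(3) i by (auto simp: G_def)
      then have "f (k ^ \<alpha> * (x + i) + r mod k ^ \<alpha>) = f (k ^ \<alpha> * (y + i) + r mod k ^ \<alpha>)"
        using xy i r' by (intro EF) (auto simp: E'_def)
      moreover have "k ^ \<alpha> * (z + i) + r mod k ^ \<alpha> = k ^ \<alpha> * z + r" for z
        by (simp add: i_def algebra_simps)
      ultimately show ?thesis by simp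
    qed
    ultimately show ?thesis by blast
  qed
  ultimately show thesis by (rule that)
qed

section \<open>Pigeonhole in a class of positive upper density\<close>

text \<open>Scaling by \<open>K / M \<le> 1\<close> does not stretch distances, so
  \<open>x - x * K div M\<close> is nondecreasing in \<open>x\<close>.\<close>

lemma scale_div_diff_le:
  fixes K M x y :: nat
  assumes "K \<le> M" "0 < M" "x \<le> y"
  shows "y * K div M + x \<le> x * K div M + y"
proof -
  have "y * K = x * K + (y - x) * K" using assms by (simp flip: distrib_right)
  also have "\<dots> \<le> x * K + (y - x) * M" using assms by simp
  finally have "y * K div M \<le> (x * K + (y - x) * M) div M" by (rule div_le_mono)
  also have "\<dots> = x * K div M + (y - x)" using assms by simp
  finally show ?thesis using assms by simp
qed

text \<open>Removing \<open>E\<close> leaves more than \<open>3/4 * d * N\<close> points of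
  \<open>A\<close> below a suitable \<open>N\<close>. The colours number fewer: the blocks of length
  \<open>L\<close>, the drift \<open>x - x * K div M\<close> and the rounding constants each cost at
  most \<open>d/4 * N\<close>. Two points of the same colour form the pair.\<close>

lemma close_pair_in_dense_class:
  fixes G :: "nat \<Rightarrow> 'b" and K M L :: nat
  assumes A: "\<exists>\<^sub>F N in sequentially. real (card (A \<inter> {0..<N})) > d * real N"
    and "d > 0" and E: "density_zero E"
    and G: "finite (range G)"
    and K: "0 < K" "K < M" and "L > 0"
    and L: "real (card (range G)) / real L \<le> d / 4"
    and KM: "real (card (range G)) * (1 - real K / real M) \<le> d / 4"
  obtains x y where "x \<in> A" "y \<in> A" "x \<notin> E" "y \<notin> E" "x < y" "y < x + L"
    "y * K div M + x = x * K div M + y" "G (x * K div M) = G (y * K div M)"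
proof -
  define q where "q = card (range G)"
  define \<phi> where "\<phi> x = x * K div M" for x
  have \<phi>_le: "\<phi> y + x \<le> \<phi> x + y" if "x \<le> y" for x y
    using scale_div_diff_le[of K M x y] that K by (simp add: \<phi>_def)
  have \<phi>_self: "\<phi> x \<le> x" for x using \<phi>_le[of 0 x] by (simp add: \<phi>_def)
  \<comment> \<open>Both summands of the first component are monotone in \<open>x\<close>, so equality of the sums forces
    equality of each; adding them rather than pairing them keeps the number of colours small.\<close>
  define \<psi> where "\<psi> x = (x div L + (x - \<phi> x), G (\<phi> x))" for x
  have ev1: "\<forall>\<^sub>F N in sequentially. real (card (E \<inter> {0..<N})) \<le> d / 4 * real N"
    using E \<open>d > 0\<close> unfolding density_zero_def by (meson divide_pos_pos zero_less_numeral)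
  have ev2: "\<forall>\<^sub>F N in sequentially. real N > 2 * real q / (d / 4)"
    using filterlim_real_sequentially filterlim_at_top_dense by blast
  \<comment> \<open>The lower bound for \<open>A\<close> holds only for infinitely many
    \<open>N\<close>, the other two for all large \<open>N\<close>; a single \<open>N\<close>
    satisfying all three is extracted.\<close>
  have "\<forall>\<^sub>F N in sequentially. real (card (A \<inter> {0..<N})) > d * real N \<longrightarrow>
     real (card (A \<inter> {0..<N})) > d * real N \<and>
     real (card (E \<inter> {0..<N})) \<le> d / 4 * real N \<and> real N > 2 * real q / (d / 4)"
    using ev1 ev2 by eventually_elim blast
  with A have "\<exists>\<^sub>F N in sequentially. real (card (A \<inter> {0..<N})) > d * real N \<and>
     real (card (E \<inter> {0..<N})) \<le> d / 4 * real N \<and> real N > 2 * real q / (d / 4)"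
    by (rule frequently_rev_mp)
  then obtain N where N: "real (card (A \<inter> {0..<N})) > d * real N"
     "real (card (E \<inter> {0..<N})) \<le> d / 4 * real N" "real N > 2 * real q / (d / 4)"
    by (auto dest: frequently_ex)
  define S where "S = (A - E) \<inter> {0..<N}"
  \<comment> \<open>The three summands bound \<open>x div L\<close>, the drift of
    \<open>x < N\<close>, and the error of the floor in \<open>\<phi>\<close>.\<close>
  define B where "B = nat \<lfloor>real N / real L + real N * (1 - real K / real M) + 1\<rfloor>"
  have "A \<inter> {0..<N} \<subseteq> S \<union> (E \<inter> {0..<N})" by (auto simp: S_def)
  then have "card (A \<inter> {0..<N}) \<le> card (S \<union> (E \<inter> {0..<N}))"
    by (intro card_mono) (auto simp: S_def)
  also have "\<dots> \<le> card S + card (E \<inter> {0..<N})" by (rule card_Un_le)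
  finally have S: "real (card S) > 3 / 4 * d * real N" using N by linarith
  have eta: "0 \<le> 1 - real K / real M" using K by simp
  have "fst (\<psi> x) \<le> B" if "x < N" for x
  proof -
    have "real x * real K / real M < real (\<phi> x) + 1"
    proof -
      have "x * K < (\<phi> x + 1) * M"
        unfolding \<phi>_def using dividend_less_div_times[of M "x * K"] K by simp
      then have "real x * real K < (real (\<phi> x) + 1) * real M"
        by (metis of_nat_1 of_nat_add of_nat_less_iff of_nat_mult)
      then show ?thesis using K by (simp add: pos_divide_less_eq)
    qed
    then have "real (x - \<phi> x) \<le> real x * (1 - real K / real M) + 1"
      using \<phi>_self[of x] by (simp add: of_nat_diff algebra_simps)
    also have "\<dots> \<le> real N * (1 - real K / real M) + 1"
      using eta that by (simp add: mult_right_mono)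
    finally have "real (x - \<phi> x) \<le> real N * (1 - real K / real M) + 1" .
    moreover have "real (x div L) \<le> real N / real L"
    proof -
      have "x div L * L \<le> N"
        using that div_times_less_eq_dividend[of x L] by linarith
      then have "real (x div L) * real L \<le> real N" by (metis of_nat_le_iff of_nat_mult)
      then show ?thesis using \<open>L > 0\<close> by (simp add: pos_le_divide_eq)
    qed
    ultimately have "real (x div L + (x - \<phi> x)) \<le>
        real N / real L + real N * (1 - real K / real M) + 1" by simp
    then show ?thesis unfolding B_def \<psi>_def fst_conv by (rule le_nat_floor)
  qed
  then have "\<psi> ` S \<subseteq> {0..B} \<times> range G" by (auto simp: S_def \<psi>_def)
  then have "card (\<psi> ` S) \<le> card ({0..B} \<times> range G)"
    using G by (intro card_mono) auto
  then have "real (card (\<psi> ` S)) \<le> real (B + 1) * real q"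
    unfolding q_def card_cartesian_product by (metis add.commute card_atLeastAtMost diff_zero
        of_nat_le_iff of_nat_mult plus_1_eq_Suc)
  \<comment> \<open>The constant rises from 1 to 2 because \<open>{0..B}\<close> has
    \<open>B + 1\<close> elements.\<close>
  also have "\<dots> \<le> (real N / real L + real N * (1 - real K / real M) + 2) * real q"
  proof (rule mult_right_mono)
    have "real B \<le> real N / real L + real N * (1 - real K / real M) + 1"
      unfolding B_def using eta by (intro of_nat_floor) (simp add: add_nonneg_nonneg)
    then show "real (B + 1) \<le> real N / real L + real N * (1 - real K / real M) + 2" by simp
  qed simp
  also have "\<dots> = real N * (real q / real L) + real N * (real q * (1 - real K / real M)) + 2 * real q"
    by (simp add: algebra_simps)
  also have "\<dots> < real N * (d / 4) + real N * (d / 4) + d / 4 * real N"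
  proof -
    have "real N * (real q / real L) \<le> real N * (d / 4)"
      "real N * (real q * (1 - real K / real M)) \<le> real N * (d / 4)"
      unfolding q_def by (intro mult_left_mono L KM of_nat_0_le_iff)+
    moreover have "2 * real q < d / 4 * real N"
      using N(3) \<open>d > 0\<close> by (simp add: field_simps)
    ultimately show ?thesis by linarith
  qed
  also have "\<dots> = 3 / 4 * d * real N" by simp
  also note S
  finally have "card (\<psi> ` S) < card S" by simp
  then have "\<not> inj_on \<psi> S" by (rule pigeonhole)
  then obtain x y where xy: "x \<in> S" "y \<in> S" "x < y" "\<psi> x = \<psi> y"
    unfolding inj_on_def by (metis linorder_neqE_nat)
  have mono: "x div L \<le> y div L" "x - \<phi> x \<le> y - \<phi> y"
    using xy(3) \<phi>_le[of x y] \<phi>_self[of x] \<phi>_self[of y] by (auto intro: div_le_mono)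
  then have eq: "x div L = y div L" "x - \<phi> x = y - \<phi> y"
    using xy(4) by (auto simp: \<psi>_def)
  have "y < x + L"
  proof -
    have "y < L + y div L * L"
      using \<open>L > 0\<close> by (rule dividend_less_div_times)
    also have "\<dots> = L + x div L * L" by (simp add: eq)
    also have "\<dots> \<le> L + x" by (simp add: div_times_less_eq_dividend)
    finally show ?thesis by simp
  qed
  moreover have "\<phi> y + x = \<phi> x + y" using eq(2) \<phi>_self[of x] \<phi>_self[of y] xy(3) by linarith
  ultimately show thesis
    using that[of x y] xy by (auto simp: S_def \<psi>_def \<phi>_def)
qed

section \<open>Local periods\<close>

lemma local_period_iterate:
  fixes f :: "nat \<Rightarrow> 'a"
  assumes "\<And>r. r < n \<Longrightarrow> f (a + r) = f (a + r + d)" "d dvd D" "r + D \<le> n"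
  shows "f (a + r) = f (a + r + D)"
proof -
  obtain c where D: "D = d * c" using assms(2) by blast
  have "r + d * c \<le> n \<Longrightarrow> f (a + r) = f (a + r + d * c)"
  proof (induction c)
    case (Suc c)
    show ?case
    proof (cases "d = 0")
      case False
      then have "f (a + (r + d * c)) = f (a + (r + d * c) + d)"
        using Suc.prems by (intro assms(1)) auto
      then show ?thesis using Suc by (simp add: algebra_simps)
    qed simp
  qed simp
  then show ?thesis using assms(3) D by simp
qed

text \<open>With \<open>p = y - x\<close>, the value at \<open>K * y + r\<close> equals that at
  \<open>K * x + r\<close> by \<open>F\<close>, and then that at \<open>K * x + r + p * M\<close> by
  \<open>G\<close>. The last position is \<open>K * y + r + p * (M - K)\<close>.\<close>

lemma block_local_period:
  fixes f :: "nat \<Rightarrow> 'a" and K M x y :: nat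
  assumes F: "\<And>r. r < 2 * K \<Longrightarrow> f (K * x + r) = f (K * y + r)"
    and G: "\<And>r. r < 3 * M \<Longrightarrow> f (M * (x * K div M) + r) = f (M * (y * K div M) + r)"
    and "x < y" "K < M" and eq: "y * K div M + x = x * K div M + y"
    and r: "r < 2 * K"
  shows "f (K * y + r) = f (K * y + r + (y - x) * (M - K))"
proof -
  define p where "p = y - x"
  \<comment> \<open>\<open>s\<close> is the offset of \<open>K * x + r\<close> within the
    \<open>M\<close>-interval; it is below \<open>M + 2 * K\<close>, hence below
    \<open>3 * M\<close>.\<close>
  define s where "s = x * K mod M + r"
  have y: "y = x + p" "y * K div M = x * K div M + p" using assms by (auto simp: p_def)
  have "x * K mod M < M" using \<open>K < M\<close> by simp
  then have s: "s < 3 * M" using r \<open>K < M\<close> unfolding s_def by linarith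
  have xs: "M * (x * K div M) + s = K * x + r" by (simp add: s_def algebra_simps)
  have "f (K * y + r) = f (K * x + r)" using F[OF r] by simp
  also have "\<dots> = f (M * (y * K div M) + s)" using G[OF s] xs by simp
  also have "M * (y * K div M) + s = K * x + r + p * M"
    unfolding y(2) using xs by (simp add: algebra_simps)
  also have "\<dots> = K * y + r + p * (M - K)"
  proof -
    have "p * M = p * K + p * (M - K)" using \<open>K < M\<close> by (simp flip: distrib_left)
    then show ?thesis by (simp add: y(1) algebra_simps)
  qed
  finally show ?thesis by (simp add: p_def)
qed

section \<open>Assembling the asymptotic period\<close>

theorem theoremA:
  fixes \<Omega> :: "'a set" and f :: "nat \<Rightarrow> 'a" and k l :: nat
  assumes "finite \<Omega>" and "\<And>n. f n \<in> \<Omega>"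
    and "k \<ge> 2" and "l \<ge> 2" and "mult_independent k l"
    and "asymp_automatic k f" and "asymp_automatic l f"
  shows "\<exists>q::nat. q \<ge> 1 \<and> almost_all (\<lambda>n. f (n + q) = f n)"
proof -
  obtain F :: "nat \<Rightarrow> ((nat \<Rightarrow> 'a) \<Rightarrow> 'a) list" where F: "finite (range F)"
    and F_block: "\<And>\<alpha>. \<exists>E. density_zero E \<and> (\<forall>x y. x \<notin> E \<longrightarrow> y \<notin> E \<longrightarrow> F x = F y \<longrightarrow>
           (\<forall>r<2 * k ^ \<alpha>. f (k ^ \<alpha> * x + r) = f (k ^ \<alpha> * y + r)))"
    using asymp_automatic_blocks[OF assms(1,2,6), of 2] by metis
  obtain G :: "nat \<Rightarrow> ((nat \<Rightarrow> 'a) \<Rightarrow> 'a) list" where G: "finite (range G)"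
    and G_block: "\<And>\<alpha>. \<exists>E. density_zero E \<and> (\<forall>x y. x \<notin> E \<longrightarrow> y \<notin> E \<longrightarrow> G x = G y \<longrightarrow>
           (\<forall>r<3 * l ^ \<alpha>. f (l ^ \<alpha> * x + r) = f (l ^ \<alpha> * y + r)))"
    using asymp_automatic_blocks[OF assms(1,2,7), of 3] by metis
  \<comment> \<open>The finitely many labels outside \<open>T\<close> together occupy density zero
    and end up in \<open>Z\<close>.\<close>
  define T where "T = {a \<in> range F. \<not> density_zero (F -` {a})}"
  have finT: "finite T" using F by (simp add: T_def)
  have "\<exists>d>0. \<exists>\<^sub>F N in sequentially. real (card (F -` {a} \<inter> {0..<N})) > d * real N"
    if "a \<in> T" for a
    using that not_density_zeroE[of "F -` {a}"] by (auto simp: T_def)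
  then obtain \<delta> where \<delta>: "\<And>a. a \<in> T \<Longrightarrow> \<delta> a > 0"
    "\<And>a. a \<in> T \<Longrightarrow> \<exists>\<^sub>F N in sequentially. real (card (F -` {a} \<inter> {0..<N})) > \<delta> a * real N"
    by metis
  \<comment> \<open>One density bound for all classes, fixed before \<open>K\<close> and
    \<open>M\<close>; inserting 1 covers an empty \<open>T\<close>.\<close>
  define d where "d = Min (insert 1 (\<delta> ` T))"
  have "d > 0" unfolding d_def using finT \<delta>(1) by (subst Min_gr_iff) auto
  have dT: "\<exists>\<^sub>F N in sequentially. real (card (F -` {a} \<inter> {0..<N})) > d * real N"
    if "a \<in> T" for a
    using \<delta>(2)[OF that]
  proof (rule frequently_elim1)
    fix N assume "real (card (F -` {a} \<inter> {0..<N})) > \<delta> a * real N"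
    moreover have "d \<le> \<delta> a" unfolding d_def using finT that by (intro Min_le) auto
    then have "d * real N \<le> \<delta> a * real N" by (intro mult_right_mono) auto
    ultimately show "real (card (F -` {a} \<inter> {0..<N})) > d * real N" by linarith
  qed
  define q where "q = card (range G)"
  have "q > 0" using G by (simp add: q_def card_gt_0_iff)
  obtain L :: nat where L: "real L > 4 * real q / d" using reals_Archimedean2 by blast
  have "4 * real q / d > 0" using \<open>d > 0\<close> \<open>q > 0\<close> by simp
  then have "L > 0" using L by (cases L) auto
  have L': "real q / real L \<le> d / 4"
    using L \<open>d > 0\<close> \<open>L > 0\<close> by (simp add: field_simps)
  \<comment> \<open>The first bound keeps the drift small in the colour count; the second ensures
    \<open>D \<le> K\<close>.\<close>
  define e where "e = min (d / (4 * real q)) (1 / fact L)"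
  have "e > 0" using \<open>d > 0\<close> \<open>q > 0\<close> by (simp add: e_def)
  obtain m n where mn: "k ^ m < l ^ n" "real (l ^ n) < (1 + e) * real (k ^ m)"
    using mult_independent_powers_close[OF assms(5,3,4) \<open>e > 0\<close>] by metis
  define K where "K = k ^ m"
  define M where "M = l ^ n"
  have K: "0 < K" "K < M" "real M < (1 + e) * real K"
    using mn assms by (auto simp: K_def M_def)
  \<comment> \<open>Every gap \<open>y - x\<close> is positive and below \<open>L\<close>, so it
    divides \<open>fact L\<close>; thus \<open>D\<close> is a multiple of all the local periods at
    once.\<close>
  define D where "D = fact L * (M - K)"
  have "real (M - K) \<le> e * real K" using K by (simp add: of_nat_diff algebra_simps)
  have KM: "real q * (1 - real K / real M) \<le> d / 4"
  proof -
    have "1 - real K / real M = real (M - K) / real M"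
      using K by (simp add: of_nat_diff field_simps)
    also have "\<dots> \<le> e * real K / real M"
      using \<open>real (M - K) \<le> e * real K\<close> by (intro divide_right_mono) auto
    also have "\<dots> \<le> e" using K \<open>e > 0\<close> by (simp add: field_simps)
    finally have "real q * (1 - real K / real M) \<le> real q * e" by (intro mult_left_mono) auto
    also have "\<dots> \<le> real q * (d / (4 * real q))"
      by (intro mult_left_mono) (auto simp: e_def)
    finally show ?thesis using \<open>q > 0\<close> by simp
  qed
  have "D \<le> K"
  proof -
    have "real D = fact L * real (M - K)" by (simp add: D_def)
    also have "\<dots> \<le> fact L * (e * real K)"
      using \<open>real (M - K) \<le> e * real K\<close> by (intro mult_left_mono) auto
    also have "\<dots> \<le> fact L * (1 / fact L * real K)"
      by (intro mult_left_mono mult_right_mono) (auto simp: e_def)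
    finally show ?thesis by simp
  qed
  obtain E where E: "density_zero E"
    and EF: "\<And>x y r. x \<notin> E \<Longrightarrow> y \<notin> E \<Longrightarrow> F x = F y \<Longrightarrow> r < 2 * K \<Longrightarrow>
           f (K * x + r) = f (K * y + r)"
    using F_block[of m] unfolding K_def by metis
  obtain E' where E': "density_zero E'"
    and EG: "\<And>x y r. x \<notin> E' \<Longrightarrow> y \<notin> E' \<Longrightarrow> G x = G y \<Longrightarrow> r < 3 * M \<Longrightarrow>
           f (M * x + r) = f (M * y + r)"
    using G_block[of n] unfolding M_def by metis
  have period: "f (K * z + r) = f (K * z + r + D)"
    if z: "F z \<in> T" "z \<notin> E" and r: "r < K" for z r
  proof -
    define E'' where "E'' = E \<union> {x. x * K div M \<in> E'}"
    have "density_zero E''"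
      unfolding E''_def using E E' K by (intro density_zero_Un density_zero_scale_div) auto
    then obtain x y where xy: "x \<in> F -` {F z}" "y \<in> F -` {F z}" "x \<notin> E''" "y \<notin> E''"
      "x < y" "y < x + L" "y * K div M + x = x * K div M + y"
      "G (x * K div M) = G (y * K div M)"
      using close_pair_in_dense_class[OF dT[OF z(1)] \<open>d > 0\<close> _ G K(1,2) \<open>L > 0\<close>]
        L' KM unfolding q_def by metis
    have "f (K * y + s) = f (K * y + s + (y - x) * (M - K))" if "s < 2 * K" for s
      using xy K that
      by (intro block_local_period EF EG) (auto simp: E''_def)
    moreover have "(y - x) * (M - K) dvd D"
      unfolding D_def using xy by (intro mult_dvd_mono dvd_fact) auto
    ultimately have "f (K * y + r) = f (K * y + r + D)"
      by (rule local_period_iterate) (use r \<open>D \<le> K\<close> in auto)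
    \<comment> \<open>The period was found at \<open>y\<close>; equal labels transport it to
      \<open>z\<close>, since \<open>r\<close> and \<open>r + D\<close> both lie below
      \<open>2 * K\<close>.\<close>
    moreover have "f (K * z + s) = f (K * y + s)" if "s < 2 * K" for s
      using xy z that by (intro EF) (auto simp: E''_def)
    then have "f (K * z + r) = f (K * y + r)" "f (K * z + (r + D)) = f (K * y + (r + D))"
      using r \<open>D \<le> K\<close> by auto
    ultimately show ?thesis by (simp add: add.assoc)
  qed
  define Z where "Z = E \<union> (\<Union>a\<in>range F - T. F -` {a})"
  have "density_zero Z"
    unfolding Z_def using E F by (intro density_zero_Un density_zero_UN) (auto simp: T_def)
  then have "density_zero {n. n * 1 div K \<in> Z}"
    using K by (intro density_zero_scale_div) auto
  moreover have "{n. f (n + D) \<noteq> f n} \<subseteq> {n. n * 1 div K \<in> Z}"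
  proof (rule subsetI, rule ccontr)
    fix n assume n: "n \<in> {n. f (n + D) \<noteq> f n}" "n \<notin> {n. n * 1 div K \<in> Z}"
    then have "F (n div K) \<in> T" "n div K \<notin> E" by (auto simp: Z_def)
    then have "f (K * (n div K) + n mod K) = f (K * (n div K) + n mod K + D)"
      using K by (intro period) auto
    then show False using n by simp
  qed
  ultimately have "almost_all (\<lambda>n. f (n + D) = f n)"
    unfolding almost_all_iff by (rule density_zero_subset)
  moreover have "D \<ge> 1" using K by (simp add: D_def Suc_le_eq)
  ultimately show ?thesis by blast
qed

end
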